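(* Let $n\ge1$ and $\Xi_n=[L_{2n-1}+1,L_{2n+1}]$. Let $u_1,u_2,\dots,u_k$ be the distinct words among $\beta^-(N)$, $N\in\Xi_n$, listed in the order of their first occurrence as $N$ increases through $\Xi_n$, and let $c_j=Z^{-1}(u_j')$, where $u_j'$ is $u_j$ with its final two letters $01$ removed. Then $k=F_{2n}$, and the sequence $(c_1,\dots,c_{F_{2n}})=\Pi^\beta_{2n}$ is the orbit of $F_{2n}-1$ under addition of $F_{2n-2}$ in $\mathbb Z/F_{2n}\mathbb Z$: $$c_1=F_{2n}-1,\qquad c_{j+1}\equiv c_j+F_{2n-2}\pmod{F_{2n}}\quad (1\le j\le F_{2n}-1).$$
   Context: Let $\varphi=(1+\sqrt5)/2$. Every integer $N\ge1$ has a unique base phi expansion $N=\sum_{i\in\mathbb Z} d_i\varphi^i$ with $d_i\in\{0,1\}$, finitely many nonzero, $d_id_{i+1}=0$; with $R$ the smallest index with $d_R=1$, $\beta^-(N)=d_{-1}\cdots d_R$. For $N\in\Xi_n$, $\beta^-(N)$ has length $2n$ and ends in $01$. Fibonacci numbers $F_0=0,F_1=1$, $F_n=F_{n-1}+F_{n-2}$; Lucas numbers $L_0=2,L_1=1$, $L_n=L_{n-1}+L_{n-2}$. For a word $e_k\cdots e_0$ over $\{0,1\}$ with no factor $11$, $Z^{-1}(e_k\cdots e_0)=\sum_i e_iF_{i+2}$ (the empty word gives $0$). *)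

theory Defs
  imports Complex_Main "HOL-Number_Theory.Number_Theory"
begin

definition phi :: real where
  "phi = (1 + sqrt 5) / 2"

fun lucas :: "nat \<Rightarrow> nat" where
  "lucas 0 = 2"
| "lucas (Suc 0) = 1"
| "lucas (Suc (Suc n)) = lucas (Suc n) + lucas n"

definition is_base_phi_expansion :: "nat \<Rightarrow> (int \<Rightarrow> nat) \<Rightarrow> bool" where
  "is_base_phi_expansion N d \<longleftrightarrow>
     (\<forall>i. d i \<in> {0, 1}) \<and> finite {i. d i \<noteq> 0} \<and> (\<forall>i. d i * d (i + 1) = 0) \<and>
     real N = (\<Sum>i | d i \<noteq> 0. real (d i) * phi powi i)"

definition base_phi_digit :: "nat \<Rightarrow> int \<Rightarrow> nat" where
  "base_phi_digit N = (THE d. is_base_phi_expansion N d)"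

definition least_index :: "nat \<Rightarrow> int" where
  "least_index N = Min {i. base_phi_digit N i = 1}"

(* Words are digit lists, leftmost letter first: [d (-1), d (-2), ..., d R] for R the
   least index. The word is empty when R is nonnegative. *)
definition beta_minus :: "nat \<Rightarrow> nat list" where
  "beta_minus N = map (\<lambda>i. base_phi_digit N (- 1 - int i)) [0..<nat (- least_index N)]"

(* Words are written e_k ... e_0, so e_i is the entry at position i of the reversed list. *)
definition Z_inv :: "nat list \<Rightarrow> nat" where
  "Z_inv w = (\<Sum>i<length w. rev w ! i * fib (i + 2))"

definition Xi :: "nat \<Rightarrow> nat set" where
  "Xi n = {lucas (2 * n - 1) + 1..lucas (2 * n + 1)}"

(* remdups keeps the last occurrence of each element; the two reversals make it keep
   the first one. *)
definition distinct_words :: "nat \<Rightarrow> nat list list" where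
  "distinct_words n = rev (remdups (rev (map beta_minus (sorted_list_of_set (Xi n)))))"

(* Indexed from 1: meaningful for j between 1 and the number of distinct words. *)
definition c_beta :: "nat \<Rightarrow> nat \<Rightarrow> nat" where
  "c_beta n j = Z_inv (butlast (butlast (distinct_words n ! (j - 1))))"

(* The sequence with superscript beta and subscript 2n. *)
definition Pi_beta_even :: "nat \<Rightarrow> nat list" where
  "Pi_beta_even n = map (c_beta n) [1..<length (distinct_words n) + 1]"

end

theory Submission
  imports Defs
begin

text \<open>
  Let \<open>x(N)\<close> be the sum of the Fibonacci numbers \<open>F\<^sub>i\<close> over the nonnegative positions \<open>i\<close> with digit
  \<open>1\<close> in the expansion of \<open>N\<close>. If \<open>A'\<close> is the algebraic conjugate of the integer part and \<open>B\<close>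
  is the fractional part, then \<open>N = x(N) \<surd>5 + A' + B\<close>, and \<open>-1 < A' + B < \<surd>5\<close>. Hence \<open>x\<close> is
  nondecreasing with steps at most \<open>1\<close>. On \<open>\<Xi>\<^sub>n\<close> it runs from \<open>F\<^sub>2\<^sub>n\<^sub>-\<^sub>1\<close> to \<open>F\<^sub>2\<^sub>n\<^sub>+\<^sub>1 - 1\<close>, since
  \<open>L\<^sub>2\<^sub>n\<^sub>+\<^sub>1\<close> is the sum of the even powers of \<open>\<phi>\<close> with exponents from \<open>-2n\<close> to \<open>2n\<close>. The numbers
  \<open>x(N)\<close> and the words \<open>\<beta>\<^sup>-(N)\<close> determine each other, so there are \<open>F\<^sub>2\<^sub>n\<close> words, listed
  by increasing \<open>x\<close>. The addition formula for Fibonacci numbers shows that the word with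
  parameter \<open>x\<close> has Zeckendorf value \<open>x F\<^sub>2\<^sub>n\<^sub>-\<^sub>2 mod F\<^sub>2\<^sub>n\<close>, so that raising \<open>x\<close> by one adds
  \<open>F\<^sub>2\<^sub>n\<^sub>-\<^sub>2\<close>. The first value is \<open>F\<^sub>2\<^sub>n - 1\<close> by Cassini's identity.
\<close>

subsection \<open>The golden ratio and its conjugate\<close>

definition psi :: real where
  "psi = 1 - phi"

lemma phi_gt_1: "phi > 1"
  by (simp add: phi_def)

lemma phi_lt_2: "phi < 2"
proof -
  have "sqrt 5 < sqrt 9" by (rule real_sqrt_less_mono) simp
  then show ?thesis by (simp add: phi_def)
qed

lemma phi_square: "phi * phi = phi + 1"
  by (simp add: phi_def field_simps)

lemma psi_square: "psi * psi = psi + 1"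
  using phi_square by (simp add: psi_def algebra_simps)

lemma psi_neq_0: "psi \<noteq> 0"
  using phi_gt_1 by (simp add: psi_def)

lemma phi_minus_psi: "phi - psi = sqrt 5"
  by (simp add: psi_def phi_def field_simps)

lemma phi_times_psi: "phi * psi = - 1"
  using phi_square by (simp add: psi_def algebra_simps)

lemma psi_powi: "psi powi i = (if even i then 1 else - 1) * phi powi (- i)"
proof -
  have "psi = - inverse phi"
    using phi_times_psi phi_gt_1 by (simp add: field_simps)
  then have "psi powi i = ((- 1) * inverse phi) powi i" by simp
  also have "\<dots> = (- 1) powi i * inverse phi powi i"
    by (rule power_int_mult_distrib)
  also have "(- 1 :: real) powi i = (if even i then 1 else - 1)"
    by (simp add: power_int_minus_left)
  finally show ?thesis by (simp add: power_int_minus power_int_inverse)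
qed

lemma powi_add_2:
  fixes r :: real
  assumes "r * r = r + 1" "r \<noteq> 0"
  shows "r powi (i + 2) = r powi (i + 1) + r powi i"
  using assms by (simp add: power_int_add power2_eq_square algebra_simps)

section \<open>Fibonacci numbers at all integer indices\<close>

definition zfib :: "int \<Rightarrow> int" where
  "zfib i = (if i \<ge> 0 then int (fib (nat i)) else (- 1) ^ (nat (- i) + 1) * int (fib (nat (- i))))"

lemma zfib_of_nat [simp]: "zfib (int k) = int (fib k)"
  by (simp add: zfib_def)

lemma zfib_0 [simp]: "zfib 0 = 0"
  by (simp add: zfib_def)

lemma zfib_1 [simp]: "zfib 1 = 1"
  by (simp add: zfib_def)

lemma zfib_add_2: "zfib (i + 2) = zfib (i + 1) + zfib i"
proof -
  consider (nonneg) "i \<ge> 0" | (m1) "i = - 1" | (neg) "i \<le> - 2" by linarith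
  then show ?thesis
  proof cases
    case nonneg
    then obtain k where "i = int k" using nonneg_eq_int by blast
    then show ?thesis by (simp add: zfib_def nat_add_distrib)
  next
    case m1
    then show ?thesis by (simp add: zfib_def)
  next
    case neg
    then obtain k where "- i - 2 = int k" using nonneg_eq_int[of "- i - 2"] by auto
    then have i: "i = - int (k + 2)" "i + 1 = - int (k + 1)" "i + 2 = - int k" by simp_all
    have *: "zfib (- int j) = (- 1) ^ (j + 1) * int (fib j)" for j
      by (simp add: zfib_def)
    have "zfib i = (- 1) ^ (k + 2 + 1) * int (fib (k + 2))" by (subst i(1)) (rule *)
    moreover have "zfib (i + 1) = (- 1) ^ (k + 1 + 1) * int (fib (k + 1))" by (subst i(2)) (rule *)
    moreover have "zfib (i + 2) = (- 1) ^ (k + 1) * int (fib k)" by (subst i(3)) (rule *)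
    ultimately show ?thesis by (simp add: algebra_simps)
  qed
qed

lemma zfib_diff_1: "zfib (i - 1) = zfib (i + 1) - zfib i"
  using zfib_add_2[of "i - 1"] by (simp add: add.commute)

lemma zfib_add_nat: "zfib (i + int j) = zfib i * zfib (int j + 1) + zfib (i - 1) * zfib (int j)"
proof (induction j arbitrary: i)
  case (Suc j)
  have "zfib (i + int (Suc j)) = zfib ((i + 1) + int j)" by (simp add: algebra_simps)
  also have "\<dots> = zfib (i + 1) * zfib (int j + 1) + zfib i * zfib (int j)"
    by (subst Suc.IH) simp
  also have "zfib (i + 1) = zfib i + zfib (i - 1)" using zfib_diff_1[of i] by simp
  finally show ?case using zfib_add_2[of "int j"] by (simp add: algebra_simps)
qed simp

text \<open>Stated for any root of \<open>r * r = r + 1\<close> so that it covers both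
  \<open>phi\<close> and \<open>psi\<close>. Subtracting the two instances gives Binet's formula at
  every integer exponent.\<close>

lemma powi_eq_zfib:
  fixes r :: real
  assumes r: "r * r = r + 1" "r \<noteq> 0"
  shows "r powi i = zfib i * r + zfib (i - 1)"
proof (induction i rule: int_induct[where k = 0])
  case base
  show ?case by (simp add: zfib_def)
next
  case (step1 i)
  have "r powi (i + 1) = r powi i * r" using r by (simp add: power_int_add)
  also have "\<dots> = zfib i * (r * r) + zfib (i - 1) * r" using step1 by (simp add: algebra_simps)
  finally show ?case unfolding r(1) zfib_diff_1[of i] by (simp add: algebra_simps)
next
  case (step2 i)
  have "r powi (i - 1) * r = r powi i" using r by (simp add: power_int_diff)
  also have "\<dots> = (zfib (i - 1) * r + zfib (i - 1 - 1)) * r"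
    using zfib_add_2[of "i - 2"] unfolding step2 distrib_right mult.assoc r(1)
    by (simp add: algebra_simps)
  finally show ?case using r(2) by simp
qed

lemma powi_diff_eq_zfib: "phi powi i - psi powi i = zfib i * sqrt 5"
  using phi_gt_1 by (simp add: powi_eq_zfib phi_square psi_square psi_neq_0 phi_minus_psi[symmetric] algebra_simps)

text \<open>Infinite descent: modulo 2 the equation forces \<open>a\<close> and \<open>b\<close> to
  be even, and halving both gives a smaller solution.\<close>

lemma quadratic_int_zero:
  fixes a b :: int
  assumes "a * a = a * b + b * b"
  shows "a = 0"
  using assms
proof (induction "nat \<bar>a\<bar>" arbitrary: a b rule: less_induct)
  case less
  have "even a \<and> even b"
  proof (rule ccontr)
    assume "\<not> (even a \<and> even b)"
    then have "odd (a * a - a * b - b * b)" by auto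
    then show False using less.prems by simp
  qed
  then obtain c d where cd: "a = 2 * c" "b = 2 * d" by (auto elim!: evenE)
  show ?case
  proof (rule ccontr)
    assume "a \<noteq> 0"
    then have "nat \<bar>c\<bar> < nat \<bar>a\<bar>" using cd by auto
    moreover have "c * c = c * d + d * d" using less.prems cd by simp
    ultimately have "c = 0" using less.hyps by blast
    then show False using cd \<open>a \<noteq> 0\<close> by simp
  qed
qed

text \<open>Squaring \<open>a * phi = - b\<close> gives \<open>a * a * phi + a * a = b * b\<close>,
  while multiplying it by \<open>a\<close> gives \<open>a * a * phi = - (a * b)\<close>. Eliminating
  \<open>phi\<close> leaves the equation of \<open>quadratic_int_zero\<close>.\<close>

lemma phi_independent:
  fixes a b :: int
  assumes "a * phi + b = 0"
  shows "a = 0"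
proof -
  have "real_of_int (a * a) * (phi + 1) = (a * phi) * (a * phi)"
    by (simp add: phi_square[symmetric])
  also have "a * phi = - real_of_int b" using assms by linarith
  finally have "real_of_int (a * a) * phi + a * a = b * b" by (simp add: algebra_simps)
  moreover have "real_of_int a * (a * phi) = - (a * b)" using \<open>a * phi = - real_of_int b\<close> by simp
  ultimately have "real_of_int (a * a) = real_of_int (a * b + b * b)" by simp
  then have "a * a = a * b + b * b" by (simp only: of_int_eq_iff)
  then show ?thesis by (rule quadratic_int_zero)
qed

subsection \<open>Existence and uniqueness of base phi expansions\<close>

definition phival :: "int set \<Rightarrow> real" where
  "phival S = (\<Sum>i\<in>S. phi powi i)"

definition psival :: "int set \<Rightarrow> real" where
  "psival S = (\<Sum>i\<in>S. psi powi i)"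

definition admissible :: "int set \<Rightarrow> bool" where
  "admissible S \<longleftrightarrow> finite S \<and> (\<forall>i\<in>S. i + 1 \<notin> S)"

lemma admissible_finite: "admissible S \<Longrightarrow> finite S"
  by (simp add: admissible_def)

lemma admissible_subset: "admissible S \<Longrightarrow> T \<subseteq> S \<Longrightarrow> admissible T"
  unfolding admissible_def by (meson finite_subset subsetD)

lemma phi_powi_pos: "phi powi i > 0"
  using phi_gt_1 by simp

lemma phi_powi_add_2: "phi powi (i + 2) = phi powi (i + 1) + phi powi i"
  using phi_gt_1 by (intro powi_add_2 phi_square) simp

lemma phi_powi_add_1: "phi powi (i + 1) = phi powi i + phi powi (i - 1)"
  using phi_powi_add_2[of "i - 1"] by (simp add: add.commute)

lemma phi_powi_mono: "i \<le> j \<Longrightarrow> phi powi i \<le> phi powi j"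
  using phi_gt_1 by (intro power_int_increasing) auto

lemma phival_nonneg: "phival S \<ge> 0"
  unfolding phival_def using phi_powi_pos by (intro sum_nonneg) (simp add: less_imp_le)

lemma phival_pos: "finite S \<Longrightarrow> S \<noteq> {} \<Longrightarrow> phival S > 0"
  unfolding phival_def using phi_powi_pos by (intro sum_pos) auto

lemma phival_insert: "finite S \<Longrightarrow> i \<notin> S \<Longrightarrow> phival (insert i S) = phi powi i + phival S"
  by (simp add: phival_def)

lemma phival_remove: "finite S \<Longrightarrow> i \<in> S \<Longrightarrow> phival S = phi powi i + phival (S - {i})"
  by (simp add: phival_def sum.remove)

text \<open>Below the largest exponent \<open>M\<close> all others are at most \<open>M - 2\<close>,
  so by induction they contribute less than \<open>phi powi (M - 1)\<close>, the gap between
  \<open>phi powi M\<close> and \<open>phi powi (M + 1)\<close>.\<close>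

lemma phival_less:
  assumes "admissible S" "\<And>i. i \<in> S \<Longrightarrow> i \<le> k"
  shows "phival S < phi powi (k + 1)"
  using assms
proof (induction "card S" arbitrary: S k rule: less_induct)
  case less
  have fin: "finite S" using less.prems(1) by (rule admissible_finite)
  show ?case
  proof (cases "S = {}")
    case True
    then show ?thesis using phi_powi_pos by (simp add: phival_def)
  next
    case False
    define M where "M = Max S"
    have M: "M \<in> S" "\<And>i. i \<in> S \<Longrightarrow> i \<le> M" using fin False by (auto simp: M_def)
    have "phival (S - {M}) < phi powi ((M - 2) + 1)"
    proof (rule less.hyps)
      show "card (S - {M}) < card S" using fin M(1) by (rule card_Diff1_less)
      show "admissible (S - {M})" using less.prems(1) by (rule admissible_subset) auto
      fix i assume "i \<in> S - {M}"
      moreover have "i + 1 \<noteq> M" if "i \<in> S" using that less.prems(1) M(1) by (auto simp: admissible_def)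
      ultimately show "i \<le> M - 2" using M(2)[of i] by force
    qed
    then have "phival S < phi powi (M + 1)"
      using phival_remove[OF fin M(1)] phi_powi_add_1[of M] by simp
    also have "\<dots> \<le> phi powi (k + 1)" using less.prems(2)[OF M(1)] by (intro phi_powi_mono) simp
    finally show ?thesis .
  qed
qed

text \<open>By \<open>phival_less\<close> the value lies between \<open>phi powi Max S\<close> and
  \<open>phi powi (Max S + 1)\<close>, so it determines the largest exponent, which is then
  removed.\<close>

lemma phival_inject:
  assumes "admissible S" "admissible T" "phival S = phival T"
  shows "S = T"
  using assms
proof (induction "card S" arbitrary: S T rule: less_induct)
  case less
  have fin: "finite S" "finite T" using less.prems by (auto intro: admissible_finite)
  show ?case
  proof (cases "S = {} \<or> T = {}")
    case True
    then show ?thesis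
      using phival_pos[OF fin(1)] phival_pos[OF fin(2)] less.prems(3) by (force simp: phival_def)
  next
    case False
    have Max_le: "Max A \<le> Max B"
      if "admissible A" "admissible B" "phival A = phival B" "A \<noteq> {}" "B \<noteq> {}" for A B
    proof -
      have "phi powi Max A \<le> phival A"
        using that phival_remove[of A "Max A"] phival_nonneg[of "A - {Max A}"]
        by (simp add: admissible_finite)
      also have "\<dots> < phi powi (Max B + 1)"
        using that by (auto intro!: phival_less simp: admissible_finite)
      finally show ?thesis
        using phi_powi_mono[of "Max B + 1" "Max A"] by linarith
    qed
    have eq: "Max S = Max T" using Max_le[of S T] Max_le[of T S] less.prems False by simp
    have mem: "Max S \<in> S" "Max S \<in> T" using Max_in[OF fin(1)] Max_in[OF fin(2)] False eq by auto
    have "S - {Max S} = T - {Max S}"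
    proof (rule less.hyps)
      show "card (S - {Max S}) < card S" using fin mem(1) by (intro card_Diff1_less)
      show "admissible (S - {Max S})" "admissible (T - {Max S})"
        using less.prems by (auto intro: admissible_subset)
      show "phival (S - {Max S}) = phival (T - {Max S})"
        using less.prems(3) phival_remove[OF fin(1) mem(1)] phival_remove[OF fin(2) mem(2)] by simp
    qed
    then show ?thesis using mem by blast
  qed
qed

text \<open>The topmost adjacent pair \<open>M\<close>, \<open>M + 1\<close> is replaced by
  \<open>M + 2\<close>. That position is free because the pair is topmost, and the number of digits
  drops, so the process ends.\<close>

lemma ex_admissible_of_finite:
  assumes "finite S"
  shows "\<exists>T. admissible T \<and> phival T = phival S"
  using assms
proof (induction "card S" arbitrary: S rule: less_induct)
  case less
  show ?case
  proof (cases "admissible S")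
    case False
    define A where "A = {i \<in> S. i + 1 \<in> S}"
    define M where "M = Max A"
    have "A \<noteq> {}" "finite A" using False less.prems by (auto simp: admissible_def A_def)
    then have "M \<in> A" "\<And>i. i \<in> A \<Longrightarrow> i \<le> M" by (auto simp: M_def)
    then have M: "M \<in> S" "M + 1 \<in> S" and "M + 1 \<notin> A" by (force simp: A_def)+
    then have "M + 2 \<notin> S" by (simp add: A_def add.assoc)
    note M = M this
    define S' where "S' = S - {M, M + 1}"
    have S': "S = insert M (insert (M + 1) S')" "M + 2 \<notin> S'" "M \<notin> S'" "M + 1 \<notin> S'" "finite S'"
      using M less.prems by (auto simp: S'_def)
    have "phival (insert (M + 2) S') = phival S"
      using S' phi_powi_add_2[of M] by (simp add: phival_insert)
    moreover have "card (insert (M + 2) S') < card S" using S' by simp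
    ultimately show ?thesis using less.hyps[of "insert (M + 2) S'"] S'(5) by auto
  qed blast
qed

text \<open>Carries use \<open>2 \<phi>\<^sup>k = \<phi>\<^sup>k\<^sup>+\<^sup>1 + \<phi>\<^sup>k\<^sup>-\<^sup>2\<close>. The position at which a digit has to be
  added moves down, past the digits already present, until it becomes free.\<close>

lemma ex_finite_add_powi:
  assumes "finite S" "\<And>i. i \<in> S \<Longrightarrow> i \<le> k \<Longrightarrow> i + 1 \<notin> S"
  shows "\<exists>T. finite T \<and> phival T = phival S + phi powi k"
  using assms
proof (induction "card {i \<in> S. i \<le> k}" arbitrary: S k rule: less_induct)
  case less
  show ?case
  proof (cases "k \<in> S")
    case False
    then show ?thesis using less.prems(1) phival_insert[of S k]
      by (intro exI[of _ "insert k S"]) simp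
  next
    case True
    define S' where "S' = S - {k}"
    have k: "k + 1 \<notin> S" "k - 1 \<notin> S" using less.prems(2)[of k] less.prems(2)[of "k - 1"] True by auto
    have S': "S = insert k S'" "k \<notin> S'" "k + 1 \<notin> S'" "finite S'"
      using True k less.prems(1) by (auto simp: S'_def)
    have "\<exists>T. finite T \<and> phival T = phival (insert (k + 1) S') + phi powi (k - 2)"
    proof (rule less.hyps)
      have "{i \<in> insert (k + 1) S'. i \<le> k - 2} \<subset> {i \<in> S. i \<le> k}" using S' by auto
      then show "card {i \<in> insert (k + 1) S'. i \<le> k - 2} < card {i \<in> S. i \<le> k}"
        using less.prems(1) by (intro psubset_card_mono) auto
      show "finite (insert (k + 1) S')" using S' by simp
      fix i assume "i \<in> insert (k + 1) S'" "i \<le> k - 2"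
      then show "i + 1 \<notin> insert (k + 1) S'" using less.prems(2)[of i] S' by auto
    qed
    moreover have "phival (insert (k + 1) S') + phi powi (k - 2) = phival S + phi powi k"
      using S' phi_powi_add_1[of k] phi_powi_add_1[of "k - 1"] by (simp add: phival_insert)
    ultimately show ?thesis by simp
  qed
qed

lemma ex_admissible_of_nat: "\<exists>S. admissible S \<and> phival S = real N"
proof (induction N)
  case 0
  show ?case by (intro exI[of _ "{}"]) (simp add: admissible_def phival_def)
next
  case (Suc N)
  then obtain S where S: "admissible S" "phival S = real N" by blast
  then obtain T where T: "finite T" "phival T = phival S + phi powi 0"
    using ex_finite_add_powi[of S 0] by (auto simp: admissible_def)
  then show ?case using ex_admissible_of_finite[of T] S by (auto simp: algebra_simps)
qed

lemma expansion_iff_admissible: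
  "is_base_phi_expansion N (\<lambda>i. of_bool (i \<in> S)) \<longleftrightarrow> admissible S \<and> phival S = real N"
  by (auto simp: is_base_phi_expansion_def admissible_def phival_def)

definition support :: "nat \<Rightarrow> int set" where
  "support N = {i. base_phi_digit N i = 1}"

lemma base_phi_digit_eq:
  assumes "admissible S" "phival S = real N"
  shows "base_phi_digit N = (\<lambda>i. of_bool (i \<in> S))"
  unfolding base_phi_digit_def
proof (rule the_equality)
  show "is_base_phi_expansion N (\<lambda>i. of_bool (i \<in> S))"
    using assms by (simp add: expansion_iff_admissible)
next
  fix d assume d: "is_base_phi_expansion N d"
  have d_eq: "d = (\<lambda>i. of_bool (i \<in> {i. d i = 1}))"
    using d by (fastforce simp: is_base_phi_expansion_def)
  then have "admissible {i. d i = 1}" "phival {i. d i = 1} = real N"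
    using d expansion_iff_admissible[of N "{i. d i = 1}"] by auto
  then have "{i. d i = 1} = S" using assms by (intro phival_inject) auto
  then show "d = (\<lambda>i. of_bool (i \<in> S))" using d_eq by simp
qed

lemma support_eq: "admissible S \<Longrightarrow> phival S = real N \<Longrightarrow> support N = S"
  by (simp add: support_def base_phi_digit_eq)

lemma admissible_support: "admissible (support N)"
  and phival_support: "phival (support N) = real N"
  using ex_admissible_of_nat[of N] support_eq[of _ N] by auto

lemma base_phi_digit_support: "base_phi_digit N i = of_bool (i \<in> support N)"
  using base_phi_digit_eq[OF admissible_support phival_support, of N] by simp

subsection \<open>The conjugate of an expansion\<close>

lemma phi_powi_nonneg: "0 \<le> phi powi i"
  using phi_powi_pos[of i] by simp

text \<open>Odd powers of \<open>psi\<close> are negative and may be dropped. The even ones are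
  powers of \<open>phi\<close> with negated exponents, and even exponents are never adjacent, so
  \<open>phival_less\<close> applies.\<close>

lemma psival_less:
  assumes "finite S" "even k" "\<And>i. i \<in> S \<Longrightarrow> even i \<Longrightarrow> k \<le> i"
  shows "psival S < phi powi (1 - k)"
proof -
  define T where "T = uminus ` {i \<in> S. even i}"
  have "psival S \<le> (\<Sum>i\<in>{i \<in> S. even i}. phi powi (- i))"
    unfolding psival_def sum.inter_filter[OF assms(1)]
    by (intro sum_mono) (simp add: psi_powi phi_powi_nonneg)
  also have "\<dots> = phival T"
    unfolding T_def phival_def by (subst sum.reindex) (auto simp: inj_on_def)
  also have "\<dots> < phi powi (- k + 1)"
  proof (intro phival_less)
    have "even i" if "i \<in> T" for i using that by (auto simp: T_def)
    then have "i + 1 \<notin> T" if "i \<in> T" for i using that even_plus_one_iff by blast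
    then show "admissible T" using assms(1) by (simp add: T_def admissible_def)
  qed (use assms in \<open>auto simp: T_def\<close>)
  finally show ?thesis by simp
qed

lemma psival_greater:
  assumes "finite S" "odd k" "\<And>i. i \<in> S \<Longrightarrow> odd i \<Longrightarrow> k \<le> i"
  shows "- (phi powi (1 - k)) < psival S"
proof -
  define T where "T = uminus ` {i \<in> S. odd i}"
  have "- psival S \<le> (\<Sum>i\<in>{i \<in> S. odd i}. phi powi (- i))"
    unfolding psival_def sum_negf[symmetric] sum.inter_filter[OF assms(1)]
    by (intro sum_mono) (simp add: psi_powi phi_powi_nonneg)
  also have "\<dots> = phival T"
    unfolding T_def phival_def by (subst sum.reindex) (auto simp: inj_on_def)
  also have "\<dots> < phi powi (- k + 1)"
  proof (intro phival_less)
    have "odd i" if "i \<in> T" for i using that by (auto simp: T_def)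
    then have "i + 1 \<notin> T" if "i \<in> T" for i using that even_plus_one_iff by blast
    then show "admissible T" using assms(1) by (simp add: T_def admissible_def)
  qed (use assms in \<open>auto simp: T_def\<close>)
  finally show ?thesis by simp
qed

section \<open>Splitting an expansion into its integer and fractional parts\<close>

definition int_part :: "int set \<Rightarrow> int set" where
  "int_part S = {i \<in> S. 0 \<le> i}"

definition frac_part :: "int set \<Rightarrow> int set" where
  "frac_part S = {i \<in> S. i < 0}"

lemma sum_split_parts:
  fixes f :: "int \<Rightarrow> 'a :: comm_monoid_add"
  assumes "finite S"
  shows "sum f S = sum f (int_part S) + sum f (frac_part S)"
  using assms by (subst sum.union_disjoint[symmetric])
    (auto simp: int_part_def frac_part_def intro!: sum.cong)

lemma finite_parts: "finite S \<Longrightarrow> finite (int_part S)" "finite S \<Longrightarrow> finite (frac_part S)"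
  by (simp_all add: int_part_def frac_part_def)

lemma admissible_parts: "admissible S \<Longrightarrow> admissible (int_part S)" "admissible S \<Longrightarrow> admissible (frac_part S)"
  by (auto intro: admissible_subset simp: int_part_def frac_part_def)

text \<open>By Binet's formula this is the coefficient of \<open>sqrt 5\<close> in the integer part
  minus its conjugate.\<close>

definition fcoef :: "int set \<Rightarrow> nat" where
  "fcoef S = (\<Sum>i\<in>int_part S. fib (nat i))"

lemma fcoef_eq_zfib: "int (fcoef S) = (\<Sum>i\<in>int_part S. zfib i)"
  by (auto simp: fcoef_def int_part_def zfib_def intro!: sum.cong)

lemma phival_eq_zfib: "phival S = of_int (\<Sum>i\<in>S. zfib i) * phi + of_int (\<Sum>i\<in>S. zfib (i - 1))"
  using phi_gt_1 by (simp add: phival_def powi_eq_zfib phi_square sum.distrib sum_distrib_right)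

lemma phival_diff_psival: "phival S - psival S = of_int (\<Sum>i\<in>S. zfib i) * sqrt 5"
  by (simp add: phival_def psival_def sum_subtractf[symmetric] powi_diff_eq_zfib sum_distrib_right)

lemma sum_zfib_eq_0:
  assumes "phival S = real N"
  shows "(\<Sum>i\<in>S. zfib i) = 0"
proof (rule phi_independent)
  show "of_int (\<Sum>i\<in>S. zfib i) * phi + of_int ((\<Sum>i\<in>S. zfib (i - 1)) - int N) = 0"
    using assms unfolding phival_eq_zfib by simp
qed

text \<open>As \<open>N\<close> is an integer, its coefficient of \<open>phi\<close> vanishes, so
  the two parts have opposite coefficients. This lets the digits after the point recover the
  parameter.\<close>

lemma fcoef_eq_frac_part:
  assumes "finite S" "phival S = real N"
  shows "int (fcoef S) = - (\<Sum>i\<in>frac_part S. zfib i)"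
  using sum_zfib_eq_0[OF assms(2)] sum_split_parts[OF assms(1), of zfib] by (simp add: fcoef_eq_zfib)

lemma real_eq_fcoef:
  assumes "finite S" "phival S = real N"
  shows "real N = real (fcoef S) * sqrt 5 + psival (int_part S) + phival (frac_part S)"
  using phival_diff_psival[of "int_part S"] sum_split_parts[OF assms(1), of "\<lambda>i. phi powi i"] assms(2)
  by (simp add: fcoef_eq_zfib[symmetric] phival_def)

lemma phival_frac_part_less_1:
  assumes "admissible S"
  shows "phival (frac_part S) < 1"
proof -
  have "phival (frac_part S) < phi powi (- 1 + 1)"
    by (rule phival_less[OF admissible_parts(2)[OF assms]]) (simp add: frac_part_def)
  then show ?thesis by simp
qed

lemma psival_int_part_less:
  assumes "finite S"
  shows "psival (int_part S) < phi"
proof -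
  have "psival (int_part S) < phi powi (1 - 0)"
    by (rule psival_less[OF finite_parts(1)[OF assms]]) (auto simp: int_part_def)
  then show ?thesis by simp
qed

lemma psival_int_part_greater:
  assumes "finite S"
  shows "- 1 < psival (int_part S)"
proof -
  have "1 \<le> i" if "i \<in> int_part S" "odd i" for i
    using that by (cases "i = 0") (auto simp: int_part_def)
  then have "- (phi powi (1 - 1)) < psival (int_part S)"
    by (intro psival_greater finite_parts(1)[OF assms]) simp_all
  then show ?thesis by simp
qed

text \<open>If the digit at \<open>-1\<close> is present, the digit at \<open>0\<close> is absent, so the two summands
  are never both close to their suprema \<open>\<phi>\<close> and \<open>1\<close>.\<close>

lemma psival_plus_phival_less:
  assumes "admissible S"
  shows "psival (int_part S) + phival (frac_part S) < sqrt 5"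
proof -
  have fin: "finite S" using assms by (rule admissible_finite)
  have inv: "phi powi (- 1) = phi - 1" using phi_powi_add_1[of 0] by simp
  have sqrt5: "sqrt 5 = 2 * phi - 1" by (simp add: phi_def field_simps)
  show ?thesis
  proof (cases "- 1 \<in> S")
    case True
    then have "0 \<notin> S" using assms by (auto simp: admissible_def)
    then have "2 \<le> i" if "i \<in> int_part S" "even i" for i
      using that by (cases "i = 0 \<or> i = 1") (auto simp: int_part_def)
    then have "psival (int_part S) < phi powi (1 - 2)"
      using fin by (intro psival_less finite_parts) auto
    then show ?thesis
      using phival_frac_part_less_1[OF assms] inv sqrt5 phi_gt_1 by simp
  next
    case False
    have "i \<le> - 2" if "i \<in> frac_part S" for i
      using that False by (cases "i = - 1") (auto simp: frac_part_def)
    then have "phival (frac_part S) < phi powi (- 2 + 1)"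
      using assms by (intro phival_less admissible_parts) auto
    then show ?thesis using psival_int_part_less[OF fin] inv sqrt5 by simp
  qed
qed

subsection \<open>The coefficient of an integer\<close>

definition xcoef :: "nat \<Rightarrow> nat" where
  "xcoef N = fcoef (support N)"

lemma finite_support: "finite (support N)"
  using admissible_support by (rule admissible_finite)

lemma xcoef_bounds:
  shows "real (xcoef N) * sqrt 5 - 1 < real N" "real N < (real (xcoef N) + 1) * sqrt 5"
  using real_eq_fcoef[OF finite_support phival_support, of N]
    psival_plus_phival_less[OF admissible_support, of N]
    psival_int_part_greater[OF finite_support, of N] phival_nonneg[of "frac_part (support N)"]
  by (simp_all add: xcoef_def algebra_simps)

lemma sqrt5_gt_2: "sqrt 5 > 2"
  by (rule real_less_rsqrt) simp

text \<open>A jump by two or more would, by the bounds, force \<open>sqrt 5 < 2\<close>.\<close>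

lemma xcoef_Suc_le: "xcoef (Suc N) \<le> xcoef N + 1"
proof (rule ccontr)
  assume "\<not> ?thesis"
  then have "(real (xcoef N) + 2) * sqrt 5 \<le> real (xcoef (Suc N)) * sqrt 5"
    by (intro mult_right_mono) auto
  then show False
    using xcoef_bounds(1)[of "Suc N"] xcoef_bounds(2)[of N] sqrt5_gt_2 by (simp add: algebra_simps)
qed

text \<open>If the value dropped, the bounds would give \<open>N' < N + 1\<close>, hence
  \<open>N = N'\<close>.\<close>

lemma xcoef_mono: "N \<le> N' \<Longrightarrow> xcoef N \<le> xcoef N'"
proof (rule ccontr)
  assume le: "N \<le> N'" and "\<not> xcoef N \<le> xcoef N'"
  then have "xcoef N' + 1 \<le> xcoef N" by simp
  then have "(real (xcoef N') + 1) * sqrt 5 \<le> real (xcoef N) * sqrt 5"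
    by (intro mult_right_mono) auto
  then have "real N' - 1 < real N"
    using xcoef_bounds(1)[of N] xcoef_bounds(2)[of N'] by (simp add: algebra_simps)
  then have "N = N'" using le by linarith
  then show False using \<open>\<not> xcoef N \<le> xcoef N'\<close> by simp
qed

text \<open>The fractional part has value \<open>b - a\<phi>\<close> with \<open>a = xcoef N\<close> and an integer \<open>b\<close>; lying in
  \<open>[0, 1)\<close>, it is determined by \<open>a\<close>.\<close>

lemma frac_part_determined:
  assumes "xcoef M = xcoef N"
  shows "frac_part (support M) = frac_part (support N)"
proof -
  define b where "b K = (\<Sum>i\<in>frac_part (support K). zfib (i - 1))" for K
  have val: "phival (frac_part (support K)) = of_int (b K) - real (xcoef K) * phi" for K
  proof -
    have "(\<Sum>i\<in>frac_part (support K). zfib i) = - int (xcoef K)"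
      using fcoef_eq_frac_part[OF finite_support phival_support, of K] by (simp add: xcoef_def)
    then show ?thesis by (simp add: phival_eq_zfib b_def)
  qed
  have "\<bar>real_of_int (b M) - real_of_int (b N)\<bar> < 1"
    using val[of M] val[of N] assms phival_frac_part_less_1[OF admissible_support, of M]
      phival_frac_part_less_1[OF admissible_support, of N]
      phival_nonneg[of "frac_part (support M)"] phival_nonneg[of "frac_part (support N)"]
    by simp
  then have "b M = b N" by linarith
  then show ?thesis
    using val[of M] val[of N] assms
    by (intro phival_inject admissible_parts admissible_support) simp
qed

subsection \<open>Lucas numbers\<close>

lemma lucas_eq_power: "real (lucas k) = phi ^ k + psi ^ k"
proof (induction k rule: lucas.induct)
  case (3 k)
  have "phi ^ Suc (Suc k) = phi ^ Suc k + phi ^ k" "psi ^ Suc (Suc k) = psi ^ Suc k + psi ^ k"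
    by (simp_all only: power_Suc mult.assoc[symmetric] phi_square psi_square) (simp_all add: algebra_simps)
  then show ?case using 3 by simp
qed (simp_all add: psi_def)

definition lucas_support :: "nat \<Rightarrow> int set" where
  "lucas_support n = (*) 2 ` {- int n..int n}"

lemma lucas_support_0: "lucas_support 0 = {0}"
  by (simp add: lucas_support_def)

lemma lucas_support_Suc:
  "lucas_support (Suc n) = insert (2 * int n + 2) (insert (- 2 * int n - 2) (lucas_support n))"
proof -
  have "{- int (Suc n)..int (Suc n)} = insert (int n + 1) (insert (- int n - 1) {- int n..int n})"
    by auto
  then show ?thesis by (simp add: lucas_support_def)
qed

lemma finite_lucas_support: "finite (lucas_support n)"
  by (simp add: lucas_support_def)

text \<open>The two new exponents contribute the Lucas number of index \<open>2 * n + 2\<close>: at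
  even exponents the conjugate of a power of \<open>phi\<close> is its inverse.\<close>

lemma phival_lucas_support: "phival (lucas_support n) = real (lucas (2 * n + 1))"
proof (induction n)
  case 0
  then show ?case by (simp add: lucas_support_0 phival_def)
next
  case (Suc n)
  have "- 2 * int n - 2 \<notin> lucas_support n" "2 * int n + 2 \<notin> insert (- 2 * int n - 2) (lucas_support n)"
    by (auto simp: lucas_support_def)
  then have "phival (lucas_support (Suc n)) =
      phi powi (2 * int n + 2) + phi powi (- 2 * int n - 2) + phival (lucas_support n)"
    by (simp only: lucas_support_Suc phival_insert finite_insert finite_lucas_support simp_thms add.assoc)
  also have "phi powi (- 2 * int n - 2) = psi powi (2 * int n + 2)"
    by (simp add: psi_powi)
  also have "phi powi (2 * int n + 2) + psi powi (2 * int n + 2) = lucas (2 * n + 2)"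
  proof -
    have "2 * int n + 2 = int (2 * n + 2)" by simp
    then show ?thesis by (simp only: power_int_of_nat lucas_eq_power)
  qed
  finally show ?case using Suc.IH by simp
qed

lemma support_lucas: "support (lucas (2 * n + 1)) = lucas_support n"
proof (rule support_eq)
  have "2 * i + 1 \<noteq> 2 * j" for i j :: int by presburger
  then show "admissible (lucas_support n)" by (auto simp: admissible_def lucas_support_def)
qed (rule phival_lucas_support)

lemma xcoef_lucas: "xcoef (lucas (2 * n + 1)) = fib (2 * n + 1) - 1"
proof -
  \<comment> \<open>The sum of the even-indexed Fibonacci numbers, written additively to keep
    truncated subtraction out of the induction.\<close>
  have "fcoef (lucas_support n) + 1 = fib (2 * n + 1)"
  proof (induction n)
    case 0
    then show ?case by (simp add: lucas_support_0 fcoef_def int_part_def Collect_conv_if)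
  next
    case (Suc n)
    have "int_part (lucas_support (Suc n)) = insert (2 * int n + 2) (int_part (lucas_support n))"
      by (auto simp: int_part_def lucas_support_Suc)
    moreover have "2 * int n + 2 \<notin> int_part (lucas_support n)"
      by (auto simp: int_part_def lucas_support_def)
    ultimately have "fcoef (lucas_support (Suc n)) = fib (nat (2 * int n + 2)) + fcoef (lucas_support n)"
      using finite_parts(1)[OF finite_lucas_support[of n]] by (simp add: fcoef_def)
    also have "nat (2 * int n + 2) = 2 * n + 2" by simp
    finally show ?case using Suc.IH by simp
  qed
  then show ?thesis unfolding xcoef_def support_lucas by simp
qed

lemma psival_lucas_int_part: "1 \<le> psival (int_part (lucas_support n))"
proof -
  have "psi powi 0 \<le> psival (int_part (lucas_support n))"
    unfolding psival_def
  proof (rule member_le_sum)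
    show "0 \<in> int_part (lucas_support n)" by (simp add: int_part_def lucas_support_def)
    show "finite (int_part (lucas_support n))" by (rule finite_parts(1)[OF finite_lucas_support])
  qed (use phi_powi_pos in \<open>auto simp: psi_powi int_part_def lucas_support_def less_imp_le\<close>)
  then show ?thesis by simp
qed

text \<open>Were the value unchanged, the fractional part would be too, and the conjugate of the
  integer part, already at least 1, would grow by 1. It would then exceed its bound
  \<open>phi\<close>.\<close>

lemma xcoef_Suc_lucas: "xcoef (lucas (2 * n + 1) + 1) = fib (2 * n + 1)"
proof -
  let ?L = "lucas (2 * n + 1)"
  have "xcoef (?L + 1) \<noteq> xcoef ?L"
  proof
    assume eq: "xcoef (?L + 1) = xcoef ?L"
    then have "frac_part (support (?L + 1)) = frac_part (support ?L)" by (rule frac_part_determined)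
    then have "psival (int_part (support (?L + 1))) = psival (int_part (support ?L)) + 1"
      using real_eq_fcoef[OF finite_support phival_support, of "?L + 1"]
        real_eq_fcoef[OF finite_support phival_support, of ?L] eq
      by (simp add: xcoef_def)
    then show False
      using psival_lucas_int_part[of n, folded support_lucas] psival_int_part_less[OF finite_support, of "?L + 1"] phi_lt_2
      by simp
  qed
  moreover have "fib (2 * n + 1) > 0" by (simp add: fib_neq_0_nat)
  ultimately show ?thesis
    using xcoef_mono[of ?L "?L + 1"] xcoef_Suc_le[of ?L] xcoef_lucas[of n] by simp
qed

subsection \<open>The words\<close>

lemma psival_frac_part:
  "psival (frac_part (support N)) = phival (frac_part (support N)) + real (xcoef N) * sqrt 5"
proof -
  have "(\<Sum>i\<in>frac_part (support N). zfib i) = - int (xcoef N)"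
    using fcoef_eq_frac_part[OF finite_support phival_support, of N] by (simp add: xcoef_def)
  then show ?thesis using phival_diff_psival[of "frac_part (support N)"] by simp
qed

text \<open>The lowest digit, at position \<open>-m\<close>, dominates the conjugate of the fractional part, whose sign is
  therefore that of \<open>(-1)\<^sup>m\<close>. As this conjugate is positive, \<open>m\<close> is even.\<close>

lemma least_digit:
  assumes "xcoef N > 0"
  obtains m where "- 2 * int m - 2 \<in> support N" "\<And>i. i \<in> support N \<Longrightarrow> - 2 * int m - 2 \<le> i"
    "fib (2 * m + 1) \<le> xcoef N" "xcoef N < fib (2 * m + 3)"
proof -
  define Q where "Q = frac_part (support N)"
  define M where "M = Min Q"
  define T where "T = Q - {M}"
  have fin: "finite Q" unfolding Q_def by (rule finite_parts(2)[OF finite_support])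
  have adm: "admissible Q" unfolding Q_def by (rule admissible_parts(2)[OF admissible_support])
  have conj_eq: "psival Q = phival Q + real (xcoef N) * sqrt 5"
    unfolding Q_def by (rule psival_frac_part)
  have conj_pos: "psival Q > 0"
    unfolding conj_eq using assms phival_nonneg[of Q] by (intro add_nonneg_pos) auto
  then have "Q \<noteq> {}" by (auto simp: psival_def)
  then have M: "M \<in> Q" "\<And>i. i \<in> Q \<Longrightarrow> M \<le> i" using fin by (auto simp: M_def)
  have "M + 1 \<notin> Q" using adm M(1) by (auto simp: admissible_def)
  have T_ge: "M + 2 \<le> i" if "i \<in> T" for i
  proof -
    have "M \<le> i" "i \<noteq> M" "i \<noteq> M + 1" using that M(2)[of i] \<open>M + 1 \<notin> Q\<close> by (auto simp: T_def)
    then show ?thesis by linarith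
  qed
  have split: "psival Q = psi powi M + psival T"
    unfolding psival_def T_def using fin M(1) by (rule sum.remove)
  \<comment> \<open>For odd \<open>M\<close> the lowest term is negative, and the positive terms, at
    even exponents from \<open>M + 3\<close> on, are too small to outweigh it.\<close>
  have "even M"
  proof (rule ccontr)
    assume odd: "odd M"
    have "psival T < phi powi (1 - (M + 3))"
    proof (rule psival_less)
      fix i assume "i \<in> T" "even i"
      moreover have "i \<noteq> M + 2" using \<open>even i\<close> odd by auto
      ultimately show "M + 3 \<le> i" using T_ge[of i] by linarith
    qed (use fin odd in \<open>simp_all add: T_def\<close>)
    also have "\<dots> \<le> phi powi (- M)" by (rule phi_powi_mono) simp
    finally show False using split odd conj_pos by (simp add: psi_powi)
  qed
  \<comment> \<open>Negative terms start at \<open>M + 3\<close>, so what remains of the lowest term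
    exceeds \<open>phi powi (- M) - phi powi (- M - 2)\<close>, which is
    \<open>phi powi (- M - 1)\<close>.\<close>
  have "- (phi powi (1 - (M + 3))) < psival T"
  proof (rule psival_greater)
    fix i assume "i \<in> T" "odd i"
    moreover have "i \<noteq> M + 2" using \<open>odd i\<close> \<open>even M\<close> by auto
    ultimately show "M + 3 \<le> i" using T_ge[of i] by linarith
  qed (use fin \<open>even M\<close> in \<open>simp_all add: T_def\<close>)
  then have lower: "phi powi (- M - 1) < psival Q"
    using split \<open>even M\<close> phi_powi_add_1[of "- M - 1"] by (simp add: psi_powi)
  have upper: "psival Q < phi powi (1 - M)"
    using fin \<open>even M\<close> M(2) by (intro psival_less)
  have "M < 0" using M(1) by (simp add: Q_def frac_part_def)
  moreover obtain k where "M = 2 * k" using \<open>even M\<close> by (rule evenE)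
  ultimately obtain m where "- k - 1 = int m" using nonneg_eq_int[of "- k - 1"] by auto
  then have m: "M = - 2 * int m - 2" using \<open>M = 2 * k\<close> by simp
  show ?thesis
  proof
    show "- 2 * int m - 2 \<in> support N" using M(1) by (simp add: m Q_def frac_part_def)
    show "- 2 * int m - 2 \<le> i" if "i \<in> support N" for i
      using M(2)[of i] that by (cases "i < 0") (simp_all add: m Q_def frac_part_def)
    have conj_fib: "phi powi int j = real (fib j) * sqrt 5 - phi powi (- int j)" if "odd j" for j
      using powi_diff_eq_zfib[of "int j"] psi_powi[of "int j"] that by simp
    have eq: "- M - 1 = int (2 * m + 1)" by (simp add: m)
    have "phi powi (- M - 1) = real (fib (2 * m + 1)) * sqrt 5 - phi powi (- int (2 * m + 1))"
      unfolding eq by (rule conj_fib) simp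
    moreover have "phi powi (- int (2 * m + 1)) \<le> phi powi 0" by (rule phi_powi_mono) simp
    moreover have "phival Q < 1" unfolding Q_def by (rule phival_frac_part_less_1[OF admissible_support])
    \<comment> \<open>The two error terms total less than 2, hence less than \<open>sqrt 5\<close>,
      so integrality yields the weak inequality.\<close>
    ultimately have "real (fib (2 * m + 1)) * sqrt 5 < (real (xcoef N) + 1) * sqrt 5"
      using lower conj_eq sqrt5_gt_2 by (simp add: algebra_simps)
    then show "fib (2 * m + 1) \<le> xcoef N" by simp
    have eq: "1 - M = int (2 * m + 3)" by (simp add: m)
    have "phi powi (1 - M) = real (fib (2 * m + 3)) * sqrt 5 - phi powi (- int (2 * m + 3))"
      unfolding eq by (rule conj_fib) simp
    then have "real (xcoef N) * sqrt 5 < real (fib (2 * m + 3)) * sqrt 5"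
      using upper conj_eq phi_powi_pos[of "- int (2 * m + 3)"] phival_nonneg[of Q] by linarith
    then show "xcoef N < fib (2 * m + 3)" by simp
  qed
qed

text \<open>The ranges of the parameter found in \<open>least_digit\<close> are disjoint for
  different \<open>m\<close>, so the range in turn fixes the lowest digit.\<close>

lemma least_digit_unique:
  assumes "fib (2 * m + 1) \<le> xcoef N" "xcoef N < fib (2 * m + 3)"
  shows "- 2 * int m - 2 \<in> support N" "i \<in> support N \<Longrightarrow> - 2 * int m - 2 \<le> i"
proof -
  have "0 < fib (2 * m + 1)" by (rule fib_neq_0_nat) simp
  then have "0 < xcoef N" using assms(1) by linarith
  then obtain k where k: "- 2 * int k - 2 \<in> support N" "\<And>i. i \<in> support N \<Longrightarrow> - 2 * int k - 2 \<le> i"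
    "fib (2 * k + 1) \<le> xcoef N" "xcoef N < fib (2 * k + 3)"
    using least_digit by blast
  have "\<not> k < m" using fib_mono[of "2 * k + 3" "2 * m + 1"] k(4) assms(1) by linarith
  moreover have "\<not> m < k" using fib_mono[of "2 * m + 3" "2 * k + 1"] k(3) assms(2) by linarith
  ultimately have "k = m" by simp
  then show "- 2 * int m - 2 \<in> support N" "i \<in> support N \<Longrightarrow> - 2 * int m - 2 \<le> i"
    using k(1,2) by simp_all
qed

lemma beta_minus_eq:
  assumes "fib (2 * m + 1) \<le> xcoef N" "xcoef N < fib (2 * m + 3)"
  shows "beta_minus N = map (\<lambda>i. of_bool (- 1 - int i \<in> frac_part (support N))) [0..<2 * m + 2]"
proof -
  have "least_index N = - 2 * int m - 2"
    unfolding least_index_def support_def[symmetric]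
    using finite_support least_digit_unique[OF assms] by (intro Min_eqI)
  then have "nat (- least_index N) = 2 * m + 2" by simp
  then show ?thesis by (simp add: beta_minus_def base_phi_digit_support frac_part_def)
qed

text \<open>The words have the same known length and list all digits after the point. These digits
  give the parameter through \<open>fcoef_eq_frac_part\<close>, and conversely
  \<open>frac_part_determined\<close> applies.\<close>

lemma beta_minus_eq_iff:
  assumes M: "fib (2 * m + 1) \<le> xcoef M" "xcoef M < fib (2 * m + 3)"
    and N: "fib (2 * m + 1) \<le> xcoef N" "xcoef N < fib (2 * m + 3)"
  shows "beta_minus M = beta_minus N \<longleftrightarrow> xcoef M = xcoef N"
proof
  assume "beta_minus M = beta_minus N"
  then have eq: "- 1 - int i \<in> frac_part (support M) \<longleftrightarrow> - 1 - int i \<in> frac_part (support N)"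
    if "i < 2 * m + 2" for i
    using that unfolding beta_minus_eq[OF M] beta_minus_eq[OF N] map_eq_conv of_bool_eq_iff set_upt
    by (meson atLeastLessThan_iff le0)
  have "j \<in> frac_part (support M) \<longleftrightarrow> j \<in> frac_part (support N)" for j
  proof (cases "- 2 * int m - 2 \<le> j \<and> j < 0")
    case True
    then show ?thesis using eq[of "nat (- 1 - j)"] by (simp add: nat_less_iff)
  next
    case False
    then show ?thesis
      using least_digit_unique(2)[OF M, of j] least_digit_unique(2)[OF N, of j]
      by (auto simp: frac_part_def)
  qed
  then have "frac_part (support M) = frac_part (support N)" by blast
  then have "int (xcoef M) = int (xcoef N)"
    using fcoef_eq_frac_part[OF finite_support phival_support, of M]
      fcoef_eq_frac_part[OF finite_support phival_support, of N]
    by (simp add: xcoef_def)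
  then show "xcoef M = xcoef N" by simp
next
  assume "xcoef M = xcoef N"
  then show "beta_minus M = beta_minus N"
    unfolding beta_minus_eq[OF M] beta_minus_eq[OF N] by (simp only: frac_part_determined[of M N])
qed

section \<open>Zeckendorf values of the words\<close>

lemma Z_inv_eq_sum_zfib:
  assumes "fib (2 * m + 1) \<le> xcoef N" "xcoef N < fib (2 * m + 3)"
  shows "int (Z_inv (butlast (butlast (beta_minus N)))) =
    (\<Sum>j\<in>frac_part (support N). zfib (j + int (2 * m + 2)))"
proof -
  define Q where "Q = frac_part (support N)"
  define g :: "nat \<Rightarrow> nat" where "g i = of_bool (- 1 - int i \<in> Q)" for i
  note least = least_digit_unique[OF assms]
  have fin: "finite Q" unfolding Q_def by (rule finite_parts(2)[OF finite_support])
  have "butlast (butlast (map h [0..<2 * m + 2])) = map h [0..<2 * m]" for h :: "nat \<Rightarrow> nat"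
    by (simp add: butlast_append)
  then have "butlast (butlast (beta_minus N)) = map g [0..<2 * m]"
    unfolding beta_minus_eq[OF assms] g_def Q_def .
  then have "int (Z_inv (butlast (butlast (beta_minus N)))) =
      (\<Sum>i<2 * m. int (g (2 * m - 1 - i)) * int (fib (i + 2)))"
    by (simp add: Z_inv_def rev_nth)
  also have "\<dots> = (\<Sum>i<2 * m. if int i - int (2 * m) \<in> Q then int (fib (i + 2)) else 0)"
    by (rule sum.cong) (auto simp: g_def of_nat_diff algebra_simps)
  also have "\<dots> = (\<Sum>i\<in>{i \<in> {..<2 * m}. int i - int (2 * m) \<in> Q}. int (fib (i + 2)))"
    by (rule sum.inter_filter[symmetric]) simp
  \<comment> \<open>Once \<open>01\<close> is cut off, the last letter sits at exponent
    \<open>- 2 * m\<close> and has weight \<open>fib 2\<close>. The deleted 0 sits just above the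
    lowest digit, where admissibility forbids a 1.\<close>
  also have "\<dots> = (\<Sum>j\<in>Q - {- 2 * int m - 2}. zfib (j + int (2 * m + 2)))"
  proof (rule sum.reindex_bij_witness[of _ "\<lambda>j. nat (j + int (2 * m))" "\<lambda>i. int i - int (2 * m)"])
    fix j assume j: "j \<in> Q - {- 2 * int m - 2}"
    have "j < 0" "j \<in> support N" using j by (auto simp: Q_def frac_part_def)
    moreover have "- 2 * int m - 2 + 1 \<notin> support N"
      using admissible_support[of N] least(1) by (auto simp: admissible_def)
    ultimately have "j \<noteq> - 2 * int m - 2 + 1" "- 2 * int m - 2 \<le> j" "j \<noteq> - 2 * int m - 2"
      using least(2)[of j] j by blast+
    then have "- 2 * int m \<le> j" by linarith
    then show "int (nat (j + int (2 * m))) - int (2 * m) = j"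
      "nat (j + int (2 * m)) \<in> {i \<in> {..<2 * m}. int i - int (2 * m) \<in> Q}"
      using j \<open>j < 0\<close> by auto
  next
    fix i :: nat assume "i \<in> {i \<in> {..<2 * m}. int i - int (2 * m) \<in> Q}"
    then show "int i - int (2 * m) \<in> Q - {- 2 * int m - 2}" by auto
    have "int i - int (2 * m) + int (2 * m + 2) = int (i + 2)" by simp
    then show "zfib (int i - int (2 * m) + int (2 * m + 2)) = int (fib (i + 2))"
      by (simp only: zfib_of_nat)
  qed simp
  \<comment> \<open>The deleted final 1 can be put back: its shifted index is 0, where
    \<open>zfib\<close> vanishes.\<close>
  also have "\<dots> = (\<Sum>j\<in>Q. zfib (j + int (2 * m + 2)))"
    using fin by (intro sum.mono_neutral_left) auto
  finally show ?thesis by (simp only: Q_def)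
qed

text \<open>With \<open>k = 2 * m + 2\<close>, the addition formula turns the sum into
  \<open>- xcoef N * fib (k + 1)\<close> modulo \<open>fib k\<close>, and \<open>fib (k + 1)\<close>
  is congruent to \<open>- fib (k - 2)\<close>.\<close>

lemma Z_inv_eq_mod:
  assumes "fib (2 * m + 1) \<le> xcoef N" "xcoef N < fib (2 * m + 3)"
  shows "Z_inv (butlast (butlast (beta_minus N))) = xcoef N * fib (2 * m) mod fib (2 * m + 2)"
    (is "?c = _")
proof -
  define Q where "Q = frac_part (support N)"
  define K where "K = (\<Sum>j\<in>Q. zfib (j - 1))"
  let ?k = "2 * m + 2"
  have c: "int ?c = (\<Sum>j\<in>Q. zfib (j + int ?k))"
    unfolding Q_def by (rule Z_inv_eq_sum_zfib[OF assms])
  have x: "(\<Sum>j\<in>Q. zfib j) = - int (xcoef N)"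
    using fcoef_eq_frac_part[OF finite_support phival_support, of N] by (simp add: Q_def xcoef_def)
  have "zfib (int ?k + 1) = int (fib (?k + 1))"
    using zfib_of_nat[of "?k + 1"] by simp
  then have "int ?c = (\<Sum>j\<in>Q. zfib j) * int (fib (?k + 1)) + K * int (fib ?k)"
    by (simp only: c zfib_add_nat sum.distrib sum_distrib_right K_def zfib_of_nat)
  also have "int (fib (?k + 1)) = 2 * int (fib ?k) - int (fib (2 * m))"
    by (simp add: numeral_eq_Suc)
  finally have "int ?c = int (xcoef N * fib (2 * m)) + int (fib ?k) * (K - 2 * int (xcoef N))"
    unfolding x by (simp add: algebra_simps)
  then have "int ?c mod int (fib ?k) = int (xcoef N * fib (2 * m)) mod int (fib ?k)"
    by (simp only: mod_mult_self2)
  then have "?c mod fib ?k = xcoef N * fib (2 * m) mod fib ?k"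
    unfolding of_nat_mod[symmetric] of_nat_eq_iff .
  \<comment> \<open>The value is a full residue: by Binet it is bounded using a fractional part
    below 1, a conjugate above 1, and a positive power of \<open>psi\<close> at the even
    exponent.\<close>
  moreover have "?c < fib ?k"
  proof -
    have "real ?c * sqrt 5 = (\<Sum>j\<in>Q. of_int (zfib (j + int ?k)) * sqrt 5)"
      using arg_cong[OF c, of real_of_int] by (simp only: of_int_sum of_int_of_nat_eq sum_distrib_right)
    also have "\<dots> = phi powi (int ?k) * phival Q - psi powi (int ?k) * psival Q"
      unfolding powi_diff_eq_zfib[symmetric] using phi_gt_1 psi_neq_0
      by (simp add: phival_def psival_def sum_distrib_right sum_subtractf power_int_add mult.commute
        del: of_nat_add of_nat_mult)
    also have "\<dots> < phi powi (int ?k) * 1 - psi powi (int ?k) * 1"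
    proof (intro diff_strict_mono mult_strict_left_mono)
      show "phival Q < 1" unfolding Q_def by (rule phival_frac_part_less_1[OF admissible_support])
      have "0 < fib (2 * m + 1)" by (rule fib_neq_0_nat) simp
      then have "1 * sqrt 5 \<le> real (xcoef N) * sqrt 5" using assms(1) by (intro mult_right_mono) auto
      then show "1 < psival Q"
        using psival_frac_part[of N] phival_nonneg[of Q] sqrt5_gt_2 unfolding Q_def by linarith
      show "0 < psi powi (int ?k)" using phi_powi_pos by (simp add: psi_powi)
    qed (rule phi_powi_pos)
    also have "\<dots> = real (fib ?k) * sqrt 5"
      by (simp only: mult_1_right powi_diff_eq_zfib zfib_of_nat of_int_of_nat_eq)
    finally show ?thesis by simp
  qed
  ultimately show ?thesis by simp
qed

subsection \<open>The order of first occurrence\<close>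

text \<open>A discrete intermediate value theorem.\<close>

lemma image_atLeastAtMost_of_unit_steps:
  fixes f :: "nat \<Rightarrow> nat"
  assumes "\<And>i. f i \<le> f (Suc i)" "\<And>i. f (Suc i) \<le> f i + 1" "a \<le> b"
  shows "f ` {a..b} = {f a..f b}"
  using assms(3)
proof (induction b rule: dec_induct)
  case (step b)
  have "f a \<le> f b" using assms(1) step(1) by (rule lift_Suc_mono_le)
  have "{a..Suc b} = insert (Suc b) {a..b}" using step(1) by auto
  then have "f ` {a..Suc b} = insert (f (Suc b)) {f a..f b}" using step.IH by simp
  then show ?case using assms(1,2)[of b] \<open>f a \<le> f b\<close> by auto
qed simp

text \<open>\<open>remdups\<close> sees only which entries are equal, so two maps with the same
  fibres on the list keep the same entries \<open>zs\<close>. Duplicates among words can thus be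
  traced on the parameter.\<close>

lemma remdups_map_parallel:
  assumes "\<And>a b. a \<in> set ys \<Longrightarrow> b \<in> set ys \<Longrightarrow> f a = f b \<longleftrightarrow> h a = h b"
  shows "\<exists>zs. set zs \<subseteq> set ys \<and> remdups (map f ys) = map f zs \<and> remdups (map h ys) = map h zs"
  using assms
proof (induction ys)
  case (Cons y ys)
  then obtain zs where zs: "set zs \<subseteq> set ys" "remdups (map f ys) = map f zs" "remdups (map h ys) = map h zs"
    by auto
  have "f y \<in> f ` set ys \<longleftrightarrow> h y \<in> h ` set ys" using Cons.prems by (auto simp: image_iff)
  then show ?case
  proof (cases "h y \<in> h ` set ys")
    case True
    then show ?thesis using zs \<open>f y \<in> f ` set ys \<longleftrightarrow> _\<close> by (intro exI[of _ zs]) auto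
  next
    case False
    then show ?thesis using zs \<open>f y \<in> f ` set ys \<longleftrightarrow> _\<close> by (intro exI[of _ "y # zs"]) auto
  qed
qed simp

lemma sorted_rev_remdups: "sorted (rev ys) \<Longrightarrow> sorted (rev (remdups ys))"
  by (induction ys) (auto simp: sorted_append)

text \<open>\<open>zs\<close> holds one integer for each word. Its parameters are sorted by
  monotonicity, distinct, and fill the whole range by unit steps, which determines their
  list.\<close>

lemma distinct_words_eq:
  obtains zs where "distinct_words (Suc m) = map beta_minus zs"
    "map xcoef zs = [fib (2 * m + 1)..<fib (2 * m + 3)]"
proof -
  define xs where "xs = sorted_list_of_set (Xi (Suc m))"
  have Xi: "Xi (Suc m) = {lucas (2 * m + 1) + 1..lucas (2 * m + 3)}"
    by (simp add: Xi_def numeral_3_eq_3)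
  then have set_xs: "set xs = {lucas (2 * m + 1) + 1..lucas (2 * m + 3)}" by (simp add: xs_def)
  have xcoef_last: "xcoef (lucas (2 * m + 3)) = fib (2 * m + 3) - 1"
    using xcoef_lucas[of "m + 1"] by (simp add: numeral_3_eq_3)
  \<comment> \<open>Positivity makes the interval \<open>Xi (Suc m)\<close> nonempty.\<close>
  have "0 < lucas (2 * m + 2)" for m by (induction m) auto
  then have "lucas (2 * m + 1) + 1 \<le> lucas (2 * m + 3)"
    by (simp add: numeral_3_eq_3 Suc_leI)
  then have "xcoef ` set xs = {xcoef (lucas (2 * m + 1) + 1)..xcoef (lucas (2 * m + 3))}"
    unfolding set_xs using xcoef_Suc_le xcoef_mono by (intro image_atLeastAtMost_of_unit_steps) auto
  then have image: "xcoef ` set xs = {fib (2 * m + 1)..<fib (2 * m + 3)}"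
    unfolding xcoef_last xcoef_Suc_lucas using fib_neq_0_nat[of "2 * m + 3"] by auto
  have "\<exists>zs. set zs \<subseteq> set (rev xs) \<and> remdups (map beta_minus (rev xs)) = map beta_minus zs \<and>
      remdups (map xcoef (rev xs)) = map xcoef zs"
  proof (rule remdups_map_parallel)
    fix M N assume "M \<in> set (rev xs)" "N \<in> set (rev xs)"
    then have "xcoef M \<in> {fib (2 * m + 1)..<fib (2 * m + 3)}" "xcoef N \<in> {fib (2 * m + 1)..<fib (2 * m + 3)}"
      using image by auto
    then show "beta_minus M = beta_minus N \<longleftrightarrow> xcoef M = xcoef N"
      by (intro beta_minus_eq_iff) auto
  qed
  then obtain zs where zs: "remdups (map beta_minus (rev xs)) = map beta_minus zs"
    "remdups (map xcoef (rev xs)) = map xcoef zs" by blast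
  show ?thesis
  proof
    show "distinct_words (Suc m) = map beta_minus (rev zs)"
      unfolding distinct_words_def xs_def[symmetric] rev_map zs(1) ..
    have "sorted xs" by (simp add: xs_def)
    then have "sorted (map xcoef xs)"
      by (auto simp: sorted_map intro: sorted_wrt_mono_rel[rotated] xcoef_mono)
    then have "sorted (rev (remdups (map xcoef (rev xs))))"
      by (intro sorted_rev_remdups) (simp add: rev_map)
    then have "sorted (map xcoef (rev zs))" unfolding zs(2) rev_map .
    moreover have "distinct (map xcoef (rev zs))"
      unfolding rev_map[symmetric] distinct_rev zs(2)[symmetric] by (rule distinct_remdups)
    moreover have "set (map xcoef (rev zs)) = set [fib (2 * m + 1)..<fib (2 * m + 3)]"
      using arg_cong[OF zs(2), of set] image by simp
    ultimately show "map xcoef (rev zs) = [fib (2 * m + 1)..<fib (2 * m + 3)]"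
      by (intro sorted_distinct_set_unique) auto
  qed
qed

section \<open>The orbit of the Zeckendorf values\<close>

lemma funpow_add_mod:
  fixes a d p :: nat
  assumes "a < p"
  shows "((\<lambda>x. (x + d) mod p) ^^ j) a = (a + j * d) mod p"
proof (induction j)
  case (Suc j)
  have "((\<lambda>x. (x + d) mod p) ^^ Suc j) a = ((a + j * d) mod p + d) mod p" using Suc.IH by simp
  also have "\<dots> = (a + Suc j * d) mod p" by (simp only: mod_add_left_eq) (simp add: ac_simps)
  finally show ?case .
qed (use assms in simp)

theorem theorem7p6:
  fixes n :: nat
  assumes "n \<ge> 1"
  shows "length (distinct_words n) = fib (2 * n) \<and>
         Pi_beta_even n =
           map (\<lambda>j. ((\<lambda>x. (x + fib (2 * n - 2)) mod fib (2 * n)) ^^ j) (fib (2 * n) - 1))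
             [0..<fib (2 * n)] \<and>
         c_beta n 1 = fib (2 * n) - 1 \<and>
         (\<forall>j. 1 \<le> j \<and> j \<le> fib (2 * n) - 1 \<longrightarrow>
           [c_beta n (j + 1) = c_beta n j + fib (2 * n - 2)] (mod fib (2 * n)))"
proof -
  obtain m where n: "n = Suc m" using assms by (cases n) auto
  define F0 F1 F2 where "F0 = fib (2 * m)" and "F1 = fib (2 * m + 1)" and "F2 = fib (2 * m + 2)"
  have fib_eqs: "fib (2 * n - 2) = F0" "fib (2 * n) = F2" "fib (2 * m + 3) = F1 + F2" "F2 = F1 + F0"
    by (simp_all add: n F0_def F1_def F2_def numeral_3_eq_3)
  have pos: "0 < F2" unfolding F2_def by (rule fib_neq_0_nat) simp
  obtain zs where words: "distinct_words n = map beta_minus zs" and xs: "map xcoef zs = [F1..<F1 + F2]"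
    using distinct_words_eq[of m] unfolding n fib_eqs F1_def by blast
  have len: "length zs = F2" using arg_cong[OF xs, of length] by simp
  have "int (F2 * F0) - int (F1\<^sup>2) = - 1"
    using fib_Cassini_int[of "2 * m"] by (simp add: F0_def F1_def F2_def)
  then have "int (F1 * F1) = int (F2 * F0 + 1)" unfolding power2_eq_square by simp
  then have square: "F1 * F1 = F2 * F0 + 1" unfolding of_nat_eq_iff .
  \<comment> \<open>Cassini's identity and \<open>F1 * (F0 + F1) = F1 * F2\<close> give that
    \<open>F1 * F0\<close> is congruent to -1 modulo \<open>F2\<close>, the starting value.
    Multiples of \<open>F2\<close> are added to stay within the naturals.\<close>
  have "F1 * F0 + (F2 * F0 + 1) = F1 * F0 + F1 * F1" by (simp only: square)
  also have "\<dots> = F1 * F2" by (simp add: fib_eqs(4) algebra_simps)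
  finally have "F1 * F0 + F2 * (F0 + 1) + 1 = F2 + F2 * F1" by (simp add: algebra_simps)
  then have "F1 * F0 + F2 * (F0 + 1) = F2 - 1 + F2 * F1" using pos by linarith
  then have "(F1 * F0 + F2 * (F0 + 1)) mod F2 = (F2 - 1 + F2 * F1) mod F2" by (rule arg_cong)
  then have start: "F1 * F0 mod F2 = (F2 - 1) mod F2"
    by (simp only: mod_mult_self2)
  \<comment> \<open>Here \<open>j\<close> counts from 0 as the distance of the parameter from its
    first value \<open>F1\<close>, whereas \<open>c_beta\<close> is indexed from 1.\<close>
  have c: "c_beta n (j + 1) = (F2 - 1 + j * F0) mod F2" if "j < F2" for j
  proof -
    have "xcoef (zs ! j) = F1 + j" using that arg_cong[OF xs, of "\<lambda>l. l ! j"] len by simp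
    moreover have "fib (2 * m + 1) = F1" "fib (2 * m + 3) = F1 + F2"
      unfolding F1_def F2_def by (simp_all add: numeral_3_eq_3)
    ultimately have "Z_inv (butlast (butlast (beta_minus (zs ! j)))) = (F1 + j) * F0 mod F2"
      using Z_inv_eq_mod[of m "zs ! j", folded F0_def F2_def] that by (simp only: add_less_cancel_left le_add1)
    then have "c_beta n (j + 1) = (F1 + j) * F0 mod F2"
      using that len by (simp add: c_beta_def words)
    also have "\<dots> = (F1 * F0 mod F2 + j * F0) mod F2" by (simp only: mod_add_left_eq distrib_right)
    finally show ?thesis unfolding start mod_add_left_eq .
  qed
  have "[1..<F2 + 1] = map Suc [0..<F2]" by (simp add: map_Suc_upt del: upt_Suc)
  then have "Pi_beta_even n = map (\<lambda>j. c_beta n (j + 1)) [0..<F2]"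
    by (simp only: Pi_beta_even_def words length_map len map_map comp_def Suc_eq_plus1)
  also have "\<dots> = map (\<lambda>j. ((\<lambda>x. (x + F0) mod F2) ^^ j) (F2 - 1)) [0..<F2]"
    using c pos by (intro map_cong) (simp_all add: funpow_add_mod)
  finally have Pi: "Pi_beta_even n = \<dots>" .
  have "[c_beta n (j + 1) = c_beta n j + F0] (mod F2)" if "1 \<le> j" "j \<le> F2 - 1" for j
  proof -
    have "c_beta n j = (F2 - 1 + (j - 1) * F0) mod F2" using c[of "j - 1"] that pos by simp
    moreover have "c_beta n (j + 1) = (F2 - 1 + j * F0) mod F2" using c[of j] that pos by simp
    moreover have "F2 - 1 + j * F0 = F2 - 1 + (j - 1) * F0 + F0" using that by (cases j) auto
    ultimately show ?thesis by (simp only: cong_def mod_add_left_eq mod_mod_trivial)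
  qed
  then show ?thesis
    unfolding fib_eqs(1,2) using Pi c[of 0] pos by (simp add: words len)
qed

end
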